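(* Let $n\ge 2$ and let $A$ be a non-hermitian $n\times n$ quaternionic matrix with numerical range $W$; put $B=W\cap\mathbb{C}$, $B^+=W\cap\mathbb{C}^+$, $B^-=W\cap\mathbb{C}^-$, $m=\min (W\cap\mathbb{R})$, $M=\max (W\cap\mathbb{R})$, $y_m=\min\{y:(x,y)\in B\}$, and for $y\in[y_m,0]$ let $x_1(y)=\min\{x:(x,y)\in B^-\}$ and $x_2(y)=\max\{x:(x,y)\in B^-\}$. Let $a=x_1'(0^-)$ and $b=x_2'(0^-)$ be the left derivatives at $0$, and let $l(y)=ay+m$ and $L(y)=by+M$. Let $\boldsymbol{\omega}=(\omega_1,\omega_2)\in B^+$. Then $$l(\omega_2)\le\omega_1\le L(\omega_2)\quad\text{if and only if}\quad \boldsymbol{\omega}\in\mathcal{C}(B),$$ where $\mathcal{C}(B)$ is the star-center of $B$.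
   Context: $\mathbb{H}$ is the real algebra of Hamilton quaternions with basis $1,i,j,k$, and $\mathbb{C}=\mathrm{span}_{\mathbb{R}}\{1,i\}\subset\mathbb{H}$, identified with $\mathbb{R}^2$ by writing $x+iy$ as $(x,y)$; $\mathbb{C}^+=\{y\ge 0\}$ and $\mathbb{C}^-=\{y\le 0\}$. The numerical range of $A$ is $W=\{\boldsymbol{x}^*A\boldsymbol{x}:\boldsymbol{x}\in\mathbb{H}^n,\ |\boldsymbol{x}|=1\}$, where $\boldsymbol{x}^*$ is the conjugate transpose and $|\boldsymbol{x}|^2=\boldsymbol{x}^*\boldsymbol{x}$; $W\cap\mathbb{R}$ is nonempty. $A$ is hermitian if $A=A^*$; for non-hermitian $A$ one has $y_m<0$. $B^-$ is convex, $x_1$ is convex and $x_2$ is concave on $[y_m,0]$, with $x_1(0)=m$ and $x_2(0)=M$, so the left derivatives at $0$ exist as extended real numbers ($a\in(-\infty,+\infty]$, $b\in[-\infty,+\infty)$); if a derivative is infinite, the convention $0\cdot(\pm\infty)=0$ is used in the formulas for $l$ and $L$. The star-center of a set $B$ is $\mathcal{C}(B)=\{b_0\in B:(1-\alpha)b_0+\alpha b\in B\text{ for all } b\in B,\ \alpha\in[0,1]\}$. *)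

theory Defs
  imports "HOL-Analysis.Analysis"
begin

section \<open>Hamilton quaternions\<close>

text \<open>\<open>Quat a b c d\<close> stands for \<open>a + b i + c j + d k\<close>.\<close>

datatype quat = Quat (qre: real) (qi: real) (qj: real) (qk: real)

lemma quat_eq_iff: "p = q \<longleftrightarrow> qre p = qre q \<and> qi p = qi q \<and> qj p = qj q \<and> qk p = qk q"
  by (cases p; cases q) simp

instantiation quat :: ring_1
begin

definition "0 = Quat 0 0 0 0"
definition "1 = Quat 1 0 0 0"
definition "p + q = Quat (qre p + qre q) (qi p + qi q) (qj p + qj q) (qk p + qk q)"
definition "p - q = Quat (qre p - qre q) (qi p - qi q) (qj p - qj q) (qk p - qk q)"
definition "- q = Quat (- qre q) (- qi q) (- qj q) (- qk q)"
definition "p * q = Quat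
  (qre p * qre q - qi p * qi q - qj p * qj q - qk p * qk q)
  (qre p * qi q + qi p * qre q + qj p * qk q - qk p * qj q)
  (qre p * qj q - qi p * qk q + qj p * qre q + qk p * qi q)
  (qre p * qk q + qi p * qj q - qj p * qi q + qk p * qre q)"

instance
  by standard
    (simp_all add: quat_eq_iff zero_quat_def one_quat_def plus_quat_def minus_quat_def
      uminus_quat_def times_quat_def algebra_simps)

end

instantiation quat :: real_algebra_1
begin

definition "r *\<^sub>R q = Quat (r * qre q) (r * qi q) (r * qj q) (r * qk q)"

instance
  by standard
    (simp_all add: quat_eq_iff scaleR_quat_def plus_quat_def times_quat_def algebra_simps)

end

text \<open>The norm is that of \<open>\<real>\<^sup>4\<close>; the library then supplies the Euclidean norm on
  \<^typ>\<open>quat ^ 'n\<close>.\<close>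

instantiation quat :: real_inner
begin

definition "p \<bullet> q = qre p * qre q + qi p * qi q + qj p * qj q + qk p * qk q"
definition "norm (q::quat) = sqrt (q \<bullet> q)"
definition "sgn (q::quat) = q /\<^sub>R norm q"
definition "dist (p::quat) q = norm (p - q)"
definition "(uniformity :: (quat \<times> quat) filter) = (INF e\<in>{0<..}. principal {(p, q). dist p q < e})"
definition "open (U :: quat set) \<longleftrightarrow>
  (\<forall>p\<in>U. \<forall>\<^sub>F (p', q) in uniformity. p' = p \<longrightarrow> q \<in> U)"

instance
proof
  fix p q r :: quat and s t :: real
  show "0 \<le> p \<bullet> p"
    by (simp add: inner_quat_def)
  show "p \<bullet> p = 0 \<longleftrightarrow> p = 0"
    by (auto simp: inner_quat_def quat_eq_iff zero_quat_def add_nonneg_eq_0_iff)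
qed (simp_all add: quat_eq_iff scaleR_quat_def plus_quat_def minus_quat_def times_quat_def
      one_quat_def zero_quat_def inner_quat_def norm_quat_def sgn_quat_def dist_quat_def
      uniformity_quat_def open_quat_def algebra_simps)

end

definition qcnj :: "quat \<Rightarrow> quat" where
  "qcnj q = Quat (qre q) (- qi q) (- qj q) (- qk q)"

definition quat_of_complex :: "complex \<Rightarrow> quat" where
  "quat_of_complex z = Quat (Re z) (Im z) 0 0"


section \<open>Quaternionic matrices and the numerical range\<close>

definition conj_transpose :: "quat ^ 'n ^ 'm \<Rightarrow> quat ^ 'm ^ 'n" where
  "conj_transpose A = (\<chi> i j. qcnj (A $ j $ i))"

definition hermitian :: "quat ^ 'n ^ 'n \<Rightarrow> bool" where
  "hermitian A \<longleftrightarrow> A = conj_transpose A"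

text \<open>\<open>cdot x y\<close> is the product \<open>x\<^sup>* y\<close> of a row and a column vector.\<close>

definition cdot :: "quat ^ 'n \<Rightarrow> quat ^ 'n \<Rightarrow> quat" where
  "cdot x y = (\<Sum>i\<in>UNIV. qcnj (x $ i) * y $ i)"

lemma cdot_self: "cdot x x = of_real ((norm x)\<^sup>2)"
proof -
  have "qcnj q * q = of_real (q \<bullet> q)" for q :: quat
    by (simp add: qcnj_def times_quat_def of_real_def scaleR_quat_def one_quat_def
        inner_quat_def)
  then show ?thesis
    by (simp add: cdot_def power2_norm_eq_inner inner_vec_def)
qed

definition numerical_range :: "quat ^ 'n ^ 'n \<Rightarrow> quat set" where
  "numerical_range A = {cdot x (A *v x) | x. norm x = 1}"


section \<open>Star-center and left derivative\<close>

definition star_center :: "'a::real_vector set \<Rightarrow> 'a set" where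
  "star_center B = {b0 \<in> B. \<forall>b\<in>B. \<forall>\<alpha>\<in>{0..1}. (1 - \<alpha>) *\<^sub>R b0 + \<alpha> *\<^sub>R b \<in> B}"

text \<open>The left derivative as an extended real. It is meaningful only where the one-sided limit of
  the difference quotients exists in \<^typ>\<open>ereal\<close>. In \<^typ>\<open>ereal\<close> the product of \<open>0\<close> and
  \<open>\<plusminus>\<infinity>\<close> is \<open>0\<close>, so \<open>a * ereal y + ereal m\<close> is a line with possibly infinite slope \<open>a\<close> through
  \<open>(0, m)\<close>, also at \<open>y = 0\<close>.\<close>

definition left_deriv :: "(real \<Rightarrow> real) \<Rightarrow> real \<Rightarrow> ereal" where
  "left_deriv f t = Lim (at_left t) (\<lambda>y. ereal ((f y - f t) / (y - t)))"

end

theory Submission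
  imports Defs
begin

text \<open>
  Conjugating a value \<open>x\<^sup>* A x\<close> by a unit quaternion \<open>v\<close> amounts to replacing \<open>x\<close> by \<open>x v\<close>, and it
  rotates the vector part of the value arbitrarily. Hence the numerical range is determined by the
  pairs \<open>(Re q, \<bar>Im q\<bar>)\<close> of its values \<open>q\<close>. These pairs form the upper bild, and \<open>B\<close> is the union
  of the upper bild and its mirror image in the real axis.

  The analytic heart is that the upper bild is convex (\<open>convex_upper_bild\<close>). Two of its points
  are given by unit vectors \<open>x\<close> and \<open>y\<close>. The vectors \<open>(1 - t) x u + t y v\<close> with \<open>t \<in> [0, 1]\<close> lead
  from one point to the other; the unit quaternions \<open>u\<close> and \<open>v\<close> do not affect these two points, but
  they control the interaction of \<open>x u\<close> and \<open>y v\<close> in between. A suitable choice makes the curve in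
  the upper bild stay below the chord between the two points, another one makes it stay above. When
  both points have the same real part, a third choice keeps the real part constant along the way,
  so that vertical sections are intervals. These three facts together give convexity.

  In dimension at least two the upper bild reaches the real axis (\<open>upper_bild_meets_axis\<close>), so
  \<open>B \<inter> \<real>\<close> is a nonempty compact interval \<open>[m, M]\<close>.

  What remains is planar geometry (\<open>star_center_iff_tangents\<close>). A point \<open>w\<close> with \<open>Im w > 0\<close> sees
  the whole upper half of \<open>B\<close> by convexity, and it sees a point \<open>z\<close> of the lower half exactly if
  the segment from \<open>w\<close> to \<open>z\<close> meets the real axis inside \<open>[m, M]\<close>. Of all points at a given
  negative height the leftmost one gives the leftmost crossing, so the crossings stay to the right
  of \<open>m\<close> exactly if \<open>w\<close> lies to the right of every line through \<open>m\<close> and a point \<open>(x\<^sub>1 y, y)\<close> of the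
  left boundary. By convexity the slopes of these lines increase towards the one-sided derivative
  \<open>a\<close> as \<open>y\<close> tends to \<open>0\<close>, so the tangent line \<open>l\<close> is the most restrictive of them. The right
  boundary is treated in the same way.
\<close>

section \<open>The division algebra of quaternions\<close>

lemma quat_components [simp]:
  "qre (p + q) = qre p + qre q" "qi (p + q) = qi p + qi q"
  "qj (p + q) = qj p + qj q" "qk (p + q) = qk p + qk q"
  "qre (p - q) = qre p - qre q" "qi (p - q) = qi p - qi q"
  "qj (p - q) = qj p - qj q" "qk (p - q) = qk p - qk q"
  "qre (- q) = - qre q" "qi (- q) = - qi q" "qj (- q) = - qj q" "qk (- q) = - qk q"
  "qre (r *\<^sub>R q) = r * qre q" "qi (r *\<^sub>R q) = r * qi q"
  "qj (r *\<^sub>R q) = r * qj q" "qk (r *\<^sub>R q) = r * qk q"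
  "qre 0 = 0" "qi 0 = 0" "qj 0 = 0" "qk 0 = 0"
  "qre 1 = 1" "qi 1 = 0" "qj 1 = 0" "qk 1 = 0"
  "qre (of_real r) = r" "qi (of_real r) = 0" "qj (of_real r) = 0" "qk (of_real r) = 0"
  "qre (qcnj q) = qre q" "qi (qcnj q) = - qi q" "qj (qcnj q) = - qj q" "qk (qcnj q) = - qk q"
  by (simp_all add: plus_quat_def minus_quat_def uminus_quat_def scaleR_quat_def
      zero_quat_def one_quat_def of_real_def qcnj_def)

lemma quat_components_mult:
  "qre (p * q) = qre p * qre q - qi p * qi q - qj p * qj q - qk p * qk q"
  "qi (p * q) = qre p * qi q + qi p * qre q + qj p * qk q - qk p * qj q"
  "qj (p * q) = qre p * qj q - qi p * qk q + qj p * qre q + qk p * qi q"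
  "qk (p * q) = qre p * qk q + qi p * qj q - qj p * qi q + qk p * qre q"
  by (simp_all add: times_quat_def)

lemma norm_quat_power2: "(norm (q::quat))\<^sup>2 = (qre q)\<^sup>2 + (qi q)\<^sup>2 + (qj q)\<^sup>2 + (qk q)\<^sup>2"
  by (simp only: power2_norm_eq_inner inner_quat_def) (simp add: power2_eq_square)

lemma quat_mult_qcnj: "q * qcnj q = of_real ((norm q)\<^sup>2)" "qcnj q * q = of_real ((norm q)\<^sup>2)"
  unfolding norm_quat_power2
  by (simp_all add: quat_eq_iff quat_components_mult power2_eq_square)

text \<open>Making the quaternions a normed division algebra provides multiplicativity of the norm, inverses
  and continuity of multiplication; as a Euclidean space they have compact unit spheres in every
  power.\<close>

instantiation quat :: real_normed_div_algebra
begin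

definition "inverse q = qcnj q /\<^sub>R (norm q)\<^sup>2"
definition "p div q = p * inverse (q::quat)"

instance
proof
  fix p q :: quat
  have "(norm (p * q))\<^sup>2 = (norm p * norm q)\<^sup>2"
    unfolding power_mult_distrib norm_quat_power2 quat_components_mult by algebra
  then show "norm (p * q) = norm p * norm q"
    by simp
  show "inverse (0::quat) = 0"
    by (simp add: inverse_quat_def quat_eq_iff)
  assume "p \<noteq> 0"
  then show "inverse p * p = 1" "p * inverse p = 1"
    by (simp_all add: inverse_quat_def quat_mult_qcnj of_real_def)
qed (simp add: divide_quat_def)

end

instantiation quat :: euclidean_space
begin

definition "Basis = {Quat 1 0 0 0, Quat 0 1 0 0, Quat 0 0 1 0, Quat 0 0 0 1}"

instance
proof
  show "(Basis :: quat set) \<noteq> {}" "finite (Basis :: quat set)"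
    by (simp_all add: Basis_quat_def)
  show "u \<bullet> v = (if u = v then 1 else 0)" if "u \<in> Basis" "v \<in> Basis" for u v :: quat
    using that unfolding Basis_quat_def inner_quat_def by (elim insertE emptyE) simp_all
  show "(\<forall>u\<in>Basis. x \<bullet> u = 0) \<longleftrightarrow> x = 0" for x :: quat
    unfolding Basis_quat_def inner_quat_def by (simp add: quat_eq_iff[of x])
qed

end

lemma qcnj_simps [simp]:
  "qcnj (qcnj q) = q" "qcnj (p + q) = qcnj p + qcnj q" "qcnj (p * q) = qcnj q * qcnj p"
  "qcnj (p - q) = qcnj p - qcnj q"
  "qcnj (r *\<^sub>R q) = r *\<^sub>R qcnj q" "qcnj (- q) = - qcnj q" "qcnj (of_real r) = of_real r"
  "qcnj 0 = 0" "qcnj 1 = 1"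
  by (simp_all add: quat_eq_iff quat_components_mult algebra_simps)

lemma norm_qcnj [simp]: "norm (qcnj q) = norm q"
  by (simp add: norm_quat_def inner_quat_def)

definition qvec :: "quat \<Rightarrow> quat" where
  "qvec q = q - of_real (qre q)"

lemma qvec_components [simp]:
  "qre (qvec q) = 0" "qi (qvec q) = qi q" "qj (qvec q) = qj q" "qk (qvec q) = qk q"
  by (simp_all add: qvec_def)

lemma qvec_simps [simp]:
  "qvec (p + q) = qvec p + qvec q" "qvec (- q) = - qvec q"
  "qvec (r *\<^sub>R q) = r *\<^sub>R qvec q" "qvec (of_real r) = 0" "qvec (qcnj q) = - qvec q"
  "qvec (qvec q) = qvec q"
  by (simp_all add: quat_eq_iff)

lemma quat_decompose: "q = of_real (qre q) + qvec q"
  by (simp add: qvec_def)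

lemma qre_inner: "qre q = q \<bullet> 1"
  by (simp add: inner_quat_def)

lemma continuous_on_qre [continuous_intros]:
  "continuous_on S f \<Longrightarrow> continuous_on S (\<lambda>x. qre (f x))"
  unfolding qre_inner by (intro continuous_intros)

lemma continuous_on_qvec [continuous_intros]:
  "continuous_on S f \<Longrightarrow> continuous_on S (\<lambda>x. qvec (f x))"
  unfolding qvec_def by (intro continuous_intros)

lemma continuous_on_qcnj [continuous_intros]:
  assumes "continuous_on S f"
  shows "continuous_on S (\<lambda>x. qcnj (f x))"
proof -
  have "qcnj q = (2 * qre q) *\<^sub>R 1 - q" for q
    by (simp add: quat_eq_iff)
  then show ?thesis
    using assms by (simp only:) (intro continuous_intros)
qed

lemma qre_conjugate: "norm v = 1 \<Longrightarrow> qre (qcnj v * q * v) = qre q"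
  and qvec_conjugate: "norm v = 1 \<Longrightarrow> qvec (qcnj v * q * v) = qcnj v * qvec q * v"
proof -
  have *: "qcnj v * of_real (qre q) * v = of_real (qre q)" if "norm v = 1"
    using that quat_mult_qcnj(2)[of v] by (simp add: of_real_def)
  have "qre (qcnj v * qvec q * v) = 0"
    by (simp add: quat_components_mult algebra_simps)
  moreover have "qcnj v * q * v = of_real (qre q) + qcnj v * qvec q * v" if "norm v = 1"
    using *[OF that] by (subst quat_decompose) (simp add: qvec_def algebra_simps)
  ultimately show "norm v = 1 \<Longrightarrow> qre (qcnj v * q * v) = qre q"
    and "norm v = 1 \<Longrightarrow> qvec (qcnj v * q * v) = qcnj v * qvec q * v"
    by (simp_all add: qvec_def)
qed

lemma norm_qvec_conjugate: "norm v = 1 \<Longrightarrow> norm (qvec (qcnj v * q * v)) = norm (qvec q)"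
  by (simp add: qvec_conjugate norm_mult)

lemma pure_quat_square: "qre p = 0 \<Longrightarrow> p * p = - of_real ((norm p)\<^sup>2)"
  unfolding norm_quat_power2
  by (simp add: quat_eq_iff quat_components_mult power2_eq_square)

text \<open>For pure \<open>p\<close> and \<open>q\<close> of equal norm, \<open>q\<^sup>2 = p\<^sup>2 = - \<bar>p\<bar>\<^sup>2\<close>, so \<open>w = \<bar>p\<bar>\<^sup>2 - q p\<close> satisfies
  \<open>q w = \<bar>p\<bar>\<^sup>2 (q + p) = w p\<close>. It vanishes only if \<open>q = - p\<close>, and then any pure quaternion
  orthogonal to \<open>p\<close> serves, since it anticommutes with \<open>p\<close>.\<close>

lemma pure_quat_intertwiner:
  assumes "qre p = 0" "qre q = 0" "norm p = norm q"
  shows "\<exists>w. w \<noteq> 0 \<and> q * w = w * p"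
proof (cases "q = - p")
  case True
  define w where "w = (if qi p = 0 \<and> qj p = 0 then Quat 0 1 0 0 else Quat 0 (qj p) (- qi p) 0)"
  have "w \<noteq> 0"
    by (auto simp: w_def quat_eq_iff)
  moreover have "q * w = w * p"
    using assms True by (auto simp: w_def quat_eq_iff quat_components_mult)
  ultimately show ?thesis
    by blast
next
  case False
  define w where "w = of_real ((norm p)\<^sup>2) - q * p"
  have "q * w = (norm p)\<^sup>2 *\<^sub>R q - (q * q) * p"
    by (simp add: w_def algebra_simps of_real_def)
  also have "\<dots> = (norm p)\<^sup>2 *\<^sub>R p - q * (p * p)"
    using pure_quat_square[OF assms(1)] pure_quat_square[OF assms(2)] assms(3)
    by (simp add: of_real_def)
  also have "\<dots> = w * p"
    by (simp add: w_def algebra_simps of_real_def)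
  finally have "q * w = w * p" .
  moreover have "w \<noteq> 0"
  proof
    assume "w = 0"
    then have "q * p * p = of_real ((norm p)\<^sup>2) * p"
      by (simp add: w_def)
    then have "- ((norm p)\<^sup>2 *\<^sub>R q) = (norm p)\<^sup>2 *\<^sub>R p"
      using pure_quat_square[OF assms(1)] by (simp add: mult.assoc of_real_def)
    then have "(norm p)\<^sup>2 *\<^sub>R (q + p) = 0"
      by (metis add.right_inverse scaleR_add_right)
    then show False
      using False assms(3) by (auto simp: eq_neg_iff_add_eq_0)
  qed
  ultimately show ?thesis
    by blast
qed

text \<open>Conjugation by unit quaternions fixes the real part and, by the intertwiner, is transitive on
  the vector parts of a given norm.\<close>

lemma quat_similar:
  assumes "qre p = qre q" "norm (qvec p) = norm (qvec q)"
  shows "\<exists>v. norm v = 1 \<and> qcnj v * q * v = p"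
proof -
  obtain w where w: "w \<noteq> 0" "qvec q * w = w * qvec p"
    using pure_quat_intertwiner[of "qvec p" "qvec q"] assms by auto
  then have qw: "q * w = w * p"
    using assms(1) by (simp add: qvec_def of_real_def left_diff_distrib right_diff_distrib)
  define v where "v = w /\<^sub>R norm w"
  have v: "norm v = 1"
    using w by (simp add: v_def)
  have "q * v = v * p"
    using qw by (simp add: v_def)
  then have "qcnj v * q * v = (qcnj v * v) * p"
    by (simp add: mult.assoc)
  also have "\<dots> = p"
    using v quat_mult_qcnj(2)[of v] by simp
  finally have "qcnj v * q * v = p" .
  with v show ?thesis
    by blast
qed


section \<open>The sesquilinear form of a quaternionic matrix\<close>

definition rscale :: "quat ^ 'n \<Rightarrow> quat \<Rightarrow> quat ^ 'n" where
  "rscale x v = (\<chi> i. x $ i * v)"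

lemma rscale_nth [simp]: "rscale x v $ i = x $ i * v"
  by (simp add: rscale_def)

lemma rscale_simps [simp]:
  "rscale x (- v) = - rscale x v" "rscale x 1 = x"
  by (simp_all add: vec_eq_iff)

lemma norm_rscale [simp]: "norm (rscale x v) = norm x * norm v"
  by (simp add: norm_vec_def norm_mult L2_set_left_distrib)

text \<open>Right scalar multiplication of either argument of \<open>x\<^sup>* A y\<close> comes out as a factor on the same side
  as that argument; this is what makes unit quaternions usable as phases below.\<close>

definition form :: "quat ^ 'n ^ 'n \<Rightarrow> quat ^ 'n \<Rightarrow> quat ^ 'n \<Rightarrow> quat" where
  "form A x y = cdot x (A *v y)"

lemma form_sum: "form A x y = (\<Sum>i\<in>UNIV. \<Sum>j\<in>UNIV. qcnj (x $ i) * A $ i $ j * y $ j)"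
  by (simp add: form_def cdot_def matrix_vector_mult_def sum_distrib_left mult.assoc)

lemma form_simps [simp]:
  "form A (x + x') y = form A x y + form A x' y"
  "form A x (y + y') = form A x y + form A x y'"
  "form A (r *\<^sub>R x) y = r *\<^sub>R form A x y"
  "form A x (r *\<^sub>R y) = r *\<^sub>R form A x y"
  "form A (x - x') y = form A x y - form A x' y"
  "form A x (y - y') = form A x y - form A x y'"
  "form A (- x) y = - form A x y"
  "form A x (- y) = - form A x y"
  "form A (rscale x v) y = qcnj v * form A x y"
  "form A x (rscale y v) = form A x y * v"
  by (simp_all add: form_sum algebra_simps sum.distrib scaleR_sum_right sum_distrib_left
      sum_distrib_right sum_negf sum_subtractf)

lemma form_combination:
  "form A (s *\<^sub>R x + t *\<^sub>R y) (s *\<^sub>R x + t *\<^sub>R y) =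
    s\<^sup>2 *\<^sub>R form A x x + t\<^sup>2 *\<^sub>R form A y y + (s * t) *\<^sub>R (form A x y + form A y x)"
  by (simp add: algebra_simps power2_eq_square)

lemma norm_combination:
  fixes x y :: "'a::real_inner"
  shows "(norm (s *\<^sub>R x + t *\<^sub>R y))\<^sup>2 =
    s\<^sup>2 * (norm x)\<^sup>2 + t\<^sup>2 * (norm y)\<^sup>2 + (s * t) * (2 * (x \<bullet> y))"
  by (simp add: power2_norm_eq_inner algebra_simps inner_commute[of y x])
    (simp add: power2_eq_square)

lemma continuous_on_form [continuous_intros]:
  assumes "continuous_on S f" "continuous_on S g"
  shows "continuous_on S (\<lambda>t. form A (f t) (g t))"
  unfolding form_sum by (intro continuous_intros continuous_on_component assms)

lemma form_rscale_diag:
  assumes "norm v = 1"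
  shows "qre (form A (rscale x v) (rscale x v)) = qre (form A x x)"
    and "norm (qvec (form A (rscale x v) (rscale x v))) = norm (qvec (form A x x))"
  using qre_conjugate[OF assms] norm_qvec_conjugate[OF assms] by (simp_all add: mult.assoc)

section \<open>Convexity of the upper bild\<close>

text \<open>A quaternion is sent to the representative in the closed upper half plane of its class under
  rotation of the vector part.\<close>

definition upper_bild :: "quat ^ 'n ^ 'n \<Rightarrow> complex set" where
  "upper_bild A = (\<lambda>x. Complex (qre (form A x x)) (norm (qvec (form A x x)))) ` sphere 0 1"

lemma upper_bildE:
  assumes "Complex h r \<in> upper_bild A"
  obtains x where "norm x = 1" "qre (form A x x) = h" "norm (qvec (form A x x)) = r"
  using assms by (auto simp: upper_bild_def)

lemma upper_bildI:
  assumes "z \<noteq> 0" "qre (form A z z) = h * (norm z)\<^sup>2" "norm (qvec (form A z z)) = r * (norm z)\<^sup>2"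
  shows "Complex h r \<in> upper_bild A"
  using assms unfolding upper_bild_def
  by (intro image_eqI[of _ _ "z /\<^sub>R norm z"]) (simp_all add: power2_eq_square field_simps)

lemma compact_upper_bild: "compact (upper_bild A)"
  unfolding upper_bild_def Complex_eq by (intro compact_continuous_image continuous_intros) simp

lemma unit_segment_through_zero:
  fixes x y :: "'a::real_normed_vector"
  assumes "norm x = 1" "norm y = 1" "0 \<le> t" "t \<le> 1" "(1 - t) *\<^sub>R x + t *\<^sub>R y = 0"
  shows "x = - y"
proof -
  have *: "(1 - t) *\<^sub>R x = t *\<^sub>R (- y)"
    using assms by (simp add: eq_neg_iff_add_eq_0)
  then have "norm ((1 - t) *\<^sub>R x) = norm (t *\<^sub>R (- y))"
    by (rule arg_cong)
  then have "1 - t = t"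
    using assms(1-4) by simp
  with * have "t *\<^sub>R x = t *\<^sub>R (- y)" "t \<noteq> 0"
    by auto
  then show ?thesis
    by (simp del: scaleR_minus_right)
qed

text \<open>Both \<open>Re (z\<^sup>* A z)\<close> and \<open>\<bar>z\<bar>\<^sup>2\<close> are quadratic in \<open>z\<close>, so a prescribed real part between those at
  the endpoints is attained by continuity and normalisation of \<open>z\<close> can be postponed.\<close>

lemma level_on_segment:
  assumes "norm x = 1" "norm y = 1" "qre (form A x x) \<le> c" "c \<le> qre (form A y y)"
    and "qre (form A x x) < qre (form A y y)"
  obtains t z where "0 \<le> t" "t \<le> 1" "z = (1 - t) *\<^sub>R x + t *\<^sub>R y" "z \<noteq> 0"
    "qre (form A z z) = c * (norm z)\<^sup>2"
proof -
  define z where "z t = (1 - t) *\<^sub>R x + t *\<^sub>R y" for t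
  define g where "g t = qre (form A (z t) (z t)) - c * (norm (z t))\<^sup>2" for t
  have "continuous_on {0..1} g"
    unfolding g_def z_def by (intro continuous_intros)
  moreover have "g 0 \<le> 0" "0 \<le> g 1"
    using assms by (simp_all add: g_def z_def)
  ultimately obtain t where t: "0 \<le> t" "t \<le> 1" "g t = 0"
    using IVT'[of g 0 0 1] by auto
  have "z t \<noteq> 0"
  proof
    assume "z t = 0"
    then have "x = - y"
      using unit_segment_through_zero[of x y t] assms t by (simp add: z_def)
    then show False
      using assms by simp
  qed
  with t show thesis
    using that[of t "z t"] by (simp add: g_def z_def)
qed

text \<open>Since a quaternion and the negative of its conjugate have equal vector parts, the cross term has
  the same vector part as \<open>F v\<close> with \<open>F = x\<^sup>* A y - (y\<^sup>* A x)\<^sup>*\<close>, and \<open>v = F\<^sup>* / \<bar>F\<bar>\<close> makes this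
  product real if \<open>F \<noteq> 0\<close>.\<close>

lemma aligned_phase:
  obtains v where "norm v = 1" "qvec (form A x (rscale y v) + form A (rscale y v) x) = 0"
proof -
  define F where "F = form A x y - qcnj (form A y x)"
  obtain v where v: "norm v = 1" "qvec (F * v) = 0"
  proof (cases "F = 0")
    case True
    then show thesis
      using that[of 1] by (simp add: qvec_def)
  next
    case False
    have "qvec (F * (qcnj F /\<^sub>R norm F)) = 0"
      by (simp add: quat_mult_qcnj del: of_real_power)
    then show thesis
      using that[of "qcnj F /\<^sub>R norm F"] False by simp
  qed
  have "qvec (form A x (rscale y v) + form A (rscale y v) x) = qvec (F * v)"
  proof -
    have "qvec (qcnj v * form A y x) = - qvec (qcnj (form A y x) * v)"
      using qvec_simps(5)[of "qcnj (form A y x) * v"] by simp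
    then show ?thesis
      by (simp add: F_def left_diff_distrib qvec_def)
  qed
  with v show thesis
    using that by simp
qed

text \<open>Let \<open>k z = p Re (z\<^sup>* A z) + q \<bar>z\<bar>\<^sup>2\<close>, whose value at unit vectors is the height of the chord. With
  an aligned phase the vector parts along \<open>(1 - t) x + t y\<close> have norm at most
  \<open>(1 - t)\<^sup>2 r1 + t\<^sup>2 r2\<close> by the triangle inequality, whereas \<open>k\<close> has in addition the cross term
  \<open>t (1 - t) \<kappa> y\<close>. This is odd in \<open>y\<close>, so replacing \<open>y\<close> by \<open>- y\<close>, which keeps the phase aligned,
  makes it nonnegative.\<close>

lemma upper_bild_below_chord:
  assumes "Complex h1 r1 \<in> upper_bild A" "Complex h2 r2 \<in> upper_bild A"
    and "h1 < h2" "h1 \<le> c" "c \<le> h2"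
    and k: "r1 = p * h1 + q" "r2 = p * h2 + q"
  shows "\<exists>r \<le> p * c + q. Complex c r \<in> upper_bild A"
proof -
  obtain x where x: "norm x = 1" "qre (form A x x) = h1" "norm (qvec (form A x x)) = r1"
    using assms(1) by (elim upper_bildE)
  obtain y0 where y0: "norm y0 = 1" "qre (form A y0 y0) = h2" "norm (qvec (form A y0 y0)) = r2"
    using assms(2) by (elim upper_bildE)
  define \<kappa> where "\<kappa> y = p * qre (form A x y + form A y x) + q * (2 * (x \<bullet> y))" for y
  obtain y where y: "norm y = 1" "qre (form A y y) = h2" "norm (qvec (form A y y)) = r2"
    "qvec (form A x y + form A y x) = 0" "0 \<le> \<kappa> y"
  proof -
    obtain v where v: "norm v = 1" "qvec (form A x (rscale y0 v) + form A (rscale y0 v) x) = 0"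
      by (rule aligned_phase)
    define y1 where "y1 = rscale y0 v"
    have y1: "norm y1 = 1" "qre (form A y1 y1) = h2" "norm (qvec (form A y1 y1)) = r2"
      "qvec (form A x y1 + form A y1 x) = 0"
      unfolding y1_def form_rscale_diag[OF v(1)] using y0 v by simp_all
    have "\<kappa> (- y1) = - \<kappa> y1"
      by (simp add: \<kappa>_def algebra_simps)
    then have "0 \<le> \<kappa> y1 \<or> 0 \<le> \<kappa> (- y1)"
      by linarith
    moreover have "qvec (form A x (- y1) + form A (- y1) x) = 0"
    proof -
      have "form A x (- y1) + form A (- y1) x = - (form A x y1 + form A y1 x)"
        by simp
      then show ?thesis
        using y1(4) by (simp only: qvec_simps(2)) simp
    qed
    ultimately show thesis
      using that[of y1] that[of "- y1"] y1 by auto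
  qed
  obtain t z where z: "0 \<le> t" "t \<le> 1" "z = (1 - t) *\<^sub>R x + t *\<^sub>R y" "z \<noteq> 0"
    "qre (form A z z) = c * (norm z)\<^sup>2"
    using level_on_segment[of x y A c] x y assms by auto
  have "qvec (form A z z) = (1 - t)\<^sup>2 *\<^sub>R qvec (form A x x) + t\<^sup>2 *\<^sub>R qvec (form A y y)
      + ((1 - t) * t) *\<^sub>R qvec (form A x y + form A y x)"
    unfolding z(3) form_combination by (simp only: qvec_simps)
  then have "norm (qvec (form A z z)) \<le> (1 - t)\<^sup>2 * r1 + t\<^sup>2 * r2"
    using x y by (auto intro!: order_trans[OF norm_triangle_ineq])
  also have "\<dots> \<le> (1 - t)\<^sup>2 * r1 + t\<^sup>2 * r2 + (1 - t) * t * \<kappa> y"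
    using y z by simp
  also have "\<dots> = p * qre (form A z z) + q * (norm z)\<^sup>2"
    unfolding z(3) form_combination norm_combination using x y
    by (simp add: k \<kappa>_def algebra_simps)
  also have "\<dots> = (p * c + q) * (norm z)\<^sup>2"
    using z by (simp add: algebra_simps)
  finally have "norm (qvec (form A z z)) / (norm z)\<^sup>2 \<le> p * c + q"
    using z by (simp add: divide_le_eq)
  moreover have "Complex c (norm (qvec (form A z z)) / (norm z)\<^sup>2) \<in> upper_bild A"
    using z by (intro upper_bildI[of z]) simp_all
  ultimately show ?thesis
    by blast
qed

lemma qi_le_norm_qvec: "qi q \<le> norm (qvec q)"
proof -
  have "(qi q)\<^sup>2 \<le> (norm (qvec q))\<^sup>2"
    by (simp add: norm_quat_power2)
  then show ?thesis
    by (rule power2_le_imp_le) simp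
qed

lemma unit_with_qi:
  assumes "norm x = 1" "norm (qvec (form A x x)) = r"
  obtains y where "norm y = 1" "qre (form A y y) = qre (form A x x)" "qi (form A y y) = r"
proof -
  have "norm (qvec (Quat (qre (form A x x)) r 0 0)) = r"
    using assms norm_quat_power2[of "qvec (Quat (qre (form A x x)) r 0 0)"]
    by (auto simp: power2_eq_iff_nonneg)
  then obtain v where "norm v = 1" "qcnj v * form A x x * v = Quat (qre (form A x x)) r 0 0"
    using quat_similar[of "Quat (qre (form A x x)) r 0 0" "form A x x"] assms by auto
  then show thesis
    using that[of "rscale x v"] assms by (simp flip: mult.assoc)
qed

text \<open>Rotating both vector parts into the direction of \<open>i\<close> replaces their norms by the coefficient of
  \<open>i\<close>, which is a quadratic form and bounds the norm from below everywhere else. It exceeds the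
  height of the chord on the whole segment as soon as the difference of the cross terms is
  nonnegative, and this is again a matter of the sign of \<open>y\<close>.\<close>

lemma upper_bild_above_chord:
  assumes "Complex h1 r1 \<in> upper_bild A" "Complex h2 r2 \<in> upper_bild A"
    and "h1 < h2" "h1 \<le> c" "c \<le> h2"
    and k: "r1 = p * h1 + q" "r2 = p * h2 + q"
  shows "\<exists>r \<ge> p * c + q. Complex c r \<in> upper_bild A"
proof -
  obtain x where x: "norm x = 1" "qre (form A x x) = h1" "qi (form A x x) = r1"
    using assms(1) by (metis upper_bildE unit_with_qi)
  obtain y1 where y1: "norm y1 = 1" "qre (form A y1 y1) = h2" "qi (form A y1 y1) = r2"
    using assms(2) by (metis upper_bildE unit_with_qi)
  define \<kappa> where "\<kappa> y = qi (form A x y + form A y x)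
      - (p * qre (form A x y + form A y x) + q * (2 * (x \<bullet> y)))" for y
  obtain y where y: "norm y = 1" "qre (form A y y) = h2" "qi (form A y y) = r2" "0 \<le> \<kappa> y"
  proof -
    have "\<kappa> (- y1) = - \<kappa> y1"
      by (simp add: \<kappa>_def algebra_simps)
    then have "0 \<le> \<kappa> y1 \<or> 0 \<le> \<kappa> (- y1)"
      by linarith
    then show thesis
      using that[of y1] that[of "- y1"] y1 by auto
  qed
  obtain t z where z: "0 \<le> t" "t \<le> 1" "z = (1 - t) *\<^sub>R x + t *\<^sub>R y" "z \<noteq> 0"
    "qre (form A z z) = c * (norm z)\<^sup>2"
    using level_on_segment[of x y A c] x y assms by auto
  have "(p * c + q) * (norm z)\<^sup>2 = p * qre (form A z z) + q * (norm z)\<^sup>2"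
    using z by (simp add: algebra_simps)
  also have "\<dots> \<le> p * qre (form A z z) + q * (norm z)\<^sup>2 + (1 - t) * t * \<kappa> y"
    using y z by simp
  also have "\<dots> = qi (form A z z)"
    unfolding z(3) form_combination norm_combination using x y
    by (simp add: k \<kappa>_def algebra_simps)
  also have "\<dots> \<le> norm (qvec (form A z z))"
    by (rule qi_le_norm_qvec)
  finally have "p * c + q \<le> norm (qvec (form A z z)) / (norm z)\<^sup>2"
    using z by (simp add: le_divide_eq)
  moreover have "Complex c (norm (qvec (form A z z)) / (norm z)\<^sup>2) \<in> upper_bild A"
    using z by (intro upper_bildI[of z]) simp_all
  ultimately show ?thesis
    by blast
qed

text \<open>Two dimensions suffice, so the kernel is sought in the span of \<open>1\<close> and \<open>i\<close>.\<close>

lemma unit_in_kernel: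
  fixes \<kappa> :: "quat \<Rightarrow> real"
  assumes "linear \<kappa>"
  obtains v where "norm v = 1" "\<kappa> v = 0"
proof -
  define i where "i = Quat 0 1 0 0"
  define w where "w = (if \<kappa> 1 = 0 then 1 else \<kappa> i *\<^sub>R 1 - \<kappa> 1 *\<^sub>R i)"
  have "w \<noteq> 0"
    by (auto simp: w_def i_def quat_eq_iff)
  moreover have "\<kappa> w = 0"
    using assms by (simp add: w_def linear_diff linear_scale)
  ultimately show thesis
    using that[of "w /\<^sub>R norm w"] assms by (simp add: linear_scale)
qed

text \<open>The cross term of \<open>Re (z\<^sup>* A z) - c \<bar>z\<bar>\<^sup>2\<close> is real linear in the phase, so some phase kills it and
  the real part is constantly \<open>c\<close> along the segment. The intermediate value theorem for the norm of
  the vector part gives the claim, unless the segment passes through \<open>0\<close>; but then its endpoints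
  are opposite and \<open>r1 = r2\<close>.\<close>

lemma upper_bild_fibre:
  assumes "Complex c r1 \<in> upper_bild A" "Complex c r2 \<in> upper_bild A" "r1 \<le> r" "r \<le> r2"
  shows "Complex c r \<in> upper_bild A"
proof -
  obtain x where x: "norm x = 1" "qre (form A x x) = c" "norm (qvec (form A x x)) = r1"
    using assms(1) by (elim upper_bildE)
  obtain y0 where y0: "norm y0 = 1" "qre (form A y0 y0) = c" "norm (qvec (form A y0 y0)) = r2"
    using assms(2) by (elim upper_bildE)
  define \<kappa> where "\<kappa> y = qre (form A x y + form A y x) - c * (2 * (x \<bullet> y))" for y
  have "linear (\<lambda>v. \<kappa> (rscale y0 v))"
  proof -
    have add: "rscale y0 (u + v) = rscale y0 u + rscale y0 v" for u v
      by (simp add: vec_eq_iff algebra_simps)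
    have scale: "rscale y0 (s *\<^sub>R v) = s *\<^sub>R rscale y0 v" for s v
      by (simp add: vec_eq_iff)
    show ?thesis
      by (rule linearI; simp only: add scale \<kappa>_def form_simps quat_components
          inner_add_right inner_scaleR_right real_scaleR_def)
        (simp_all add: algebra_simps)
  qed
  then obtain v where v: "norm v = 1" "\<kappa> (rscale y0 v) = 0"
    by (rule unit_in_kernel)
  define y where "y = rscale y0 v"
  have y: "norm y = 1" "qre (form A y y) = c" "norm (qvec (form A y y)) = r2" "\<kappa> y = 0"
    unfolding y_def form_rscale_diag[OF v(1)] using y0 v by simp_all
  define z where "z t = (1 - t) *\<^sub>R x + t *\<^sub>R y" for t
  have h: "qre (form A (z t) (z t)) = c * (norm (z t))\<^sup>2" for t
  proof -
    have "qre (form A (z t) (z t)) - c * (norm (z t))\<^sup>2 = (1 - t) * t * \<kappa> y"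
      unfolding z_def form_combination norm_combination using x y(1-3)
      by (simp add: \<kappa>_def algebra_simps)
    then show ?thesis
      using y by simp
  qed
  show ?thesis
  proof (cases "\<exists>t\<in>{0..1}. z t = 0")
    case True
    then have "x = - y"
      using unit_segment_through_zero[of x y] x y by (auto simp: z_def)
    then have "r1 = r2"
      using x y by simp
    then show ?thesis
      using assms by auto
  next
    case False
    define g where "g t = norm (qvec (form A (z t) (z t))) / (norm (z t))\<^sup>2" for t
    have "continuous_on {0..1} g"
      unfolding g_def using False by (auto simp: z_def intro!: continuous_intros)
    moreover have "g 0 = r1" "g 1 = r2"
      using x y by (simp_all add: g_def z_def)
    ultimately obtain t where t: "0 \<le> t" "t \<le> 1" "g t = r"
      using IVT'[of g 0 r 1] assms by auto
    then show ?thesis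
      using False h[of t] by (intro upper_bildI[of "z t"]) (auto simp: g_def)
  qed
qed

lemma convex_upper_bild: "convex (upper_bild A)"
proof -
  have *: "u *\<^sub>R w1 + v *\<^sub>R w2 \<in> upper_bild A"
    if w: "w1 \<in> upper_bild A" "w2 \<in> upper_bild A" and uv: "0 \<le> u" "0 \<le> v" "u + v = 1"
      and le: "Re w1 \<le> Re w2" for w1 w2 u v
  proof -
    define c where "c = u * Re w1 + v * Re w2"
    define s where "s = u * Im w1 + v * Im w2"
    have eq: "u *\<^sub>R w1 + v *\<^sub>R w2 = Complex c s"
      by (simp add: complex_eq_iff c_def s_def)
    have u: "u = 1 - v"
      using uv by simp
    show ?thesis
    proof (cases "Re w1 = Re w2")
      case True
      have w': "Complex c (Im w1) \<in> upper_bild A" "Complex c (Im w2) \<in> upper_bild A"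
        using w True by (simp_all add: c_def u algebra_simps complex_surj)
          (metis complex.collapse)
      have "s \<in> closed_segment (Im w1) (Im w2)"
        using uv by (auto simp: s_def closed_segment_def u)
      then have "Im w1 \<le> s \<and> s \<le> Im w2 \<or> Im w2 \<le> s \<and> s \<le> Im w1"
        by (auto simp: closed_segment_eq_real_ivl split: if_splits)
      then show ?thesis
        unfolding eq using upper_bild_fibre[OF w'] upper_bild_fibre[OF w'(2,1)] by blast
    next
      case False
      define p where "p = (Im w2 - Im w1) / (Re w2 - Re w1)"
      define q where "q = Im w1 - p * Re w1"
      have k: "Im w1 = p * Re w1 + q" "Im w2 = p * Re w2 + q"
      proof -
        have "p * (Re w2 - Re w1) = Im w2 - Im w1"
          using False by (simp add: p_def)
        then show "Im w1 = p * Re w1 + q" "Im w2 = p * Re w2 + q"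
          by (simp_all add: q_def algebra_simps)
      qed
      have s: "s = p * c + q"
        unfolding s_def c_def k by (simp add: u algebra_simps)
      have c: "Re w1 \<le> c" "c \<le> Re w2"
        using convex_bound_le[of "Re w1" "Re w2" "Re w2" u v] le uv
          mult_left_mono[OF le uv(2)] by (simp_all add: c_def u algebra_simps)
      have w': "Complex (Re w1) (Im w1) \<in> upper_bild A" "Complex (Re w2) (Im w2) \<in> upper_bild A"
        using w by simp_all
      obtain r where r: "r \<le> s" "Complex c r \<in> upper_bild A"
        using upper_bild_below_chord[OF w' _ c k] le False s by auto
      obtain r' where r': "s \<le> r'" "Complex c r' \<in> upper_bild A"
        using upper_bild_above_chord[OF w' _ c k] le False s by auto
      show ?thesis
        unfolding eq using upper_bild_fibre r r' by blast
    qed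
  qed
  show ?thesis
  proof (rule convexI)
    fix w1 w2 :: complex and u v :: real
    assume "w1 \<in> upper_bild A" "w2 \<in> upper_bild A" "0 \<le> u" "0 \<le> v" "u + v = 1"
    then show "u *\<^sub>R w1 + v *\<^sub>R w2 \<in> upper_bild A"
      using *[of w1 w2 u v] *[of w2 w1 v u] by (cases "Re w1 \<le> Re w2") (auto simp: add.commute)
  qed
qed


text \<open>The form \<open>\<sigma> u v = u\<^sup>* (A - A\<^sup>*) v\<close> is skew-hermitian and \<open>\<sigma> u u\<close> is twice the vector part of
  \<open>u\<^sup>* A u\<close>. If this is nonzero at a unit coordinate vector \<open>x\<close>, then a Gram-Schmidt step turns a
  second coordinate vector into \<open>y\<close> with \<open>\<sigma> x y = 0\<close>. On combinations of \<open>x\<close> and \<open>y v\<close> the vector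
  parts then add without a cross term, so it is enough to rotate that of \<open>y\<close> opposite to that of
  \<open>x\<close> and to choose weights that make them cancel.\<close>

lemma upper_bild_meets_axis:
  fixes A :: "quat ^ 'n ^ 'n"
  assumes "2 \<le> CARD('n)"
  obtains h where "Complex h 0 \<in> upper_bild A"
proof -
  obtain i j :: 'n where ij: "i \<noteq> j"
    using assms by (metis card_2_iff' obtain_subset_with_card_n insertI1 subset_UNIV)
  define x :: "quat ^ 'n" where "x = axis i 1"
  define y0 :: "quat ^ 'n" where "y0 = axis j 1"
  define \<sigma> where "\<sigma> u v = form A u v - qcnj (form A v u)" for u v
  define p where "p = qvec (form A x x)"
  show thesis
  proof (cases "p = 0")
    case True
    then show thesis
      using that upper_bildI[of x A "qre (form A x x) / (norm x)\<^sup>2" 0]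
      by (simp add: p_def x_def axis_eq_0_iff)
  next
    case False
    define w where "w = inverse (2 *\<^sub>R p) * \<sigma> x y0"
    define y where "y = y0 + rscale x (- w)"
    have "\<sigma> x x = 2 *\<^sub>R p"
      by (simp add: \<sigma>_def p_def quat_eq_iff)
    moreover have "\<sigma> x y = \<sigma> x y0 - \<sigma> x x * w"
      unfolding \<sigma>_def y_def by (simp add: algebra_simps)
    moreover have "2 *\<^sub>R p * w = \<sigma> x y0"
      unfolding w_def mult.assoc[symmetric] using False by (subst right_inverse) auto
    ultimately have orth: "\<sigma> x y = 0"
      by simp
    have coord: "x $ j = 0" "y $ j = 1"
      using ij by (simp_all add: x_def y_def y0_def axis_def)
    define q where "q = qvec (form A y y)"
    obtain v where v: "norm v = 1" "qcnj v * (norm p *\<^sub>R q) * v = - (norm q *\<^sub>R p)"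
      using quat_similar[of "- (norm q *\<^sub>R p)" "norm p *\<^sub>R q"] by (auto simp: p_def q_def)
    define z where "z = sqrt (norm q) *\<^sub>R x + sqrt (norm p) *\<^sub>R rscale y v"
    \<comment> \<open>The vector \<open>x\<close> does not contribute to coordinate \<open>j\<close>.\<close>
    have "z $ j = sqrt (norm p) *\<^sub>R v"
      by (simp add: z_def coord)
    with v False have "z \<noteq> 0"
      by auto
    have cross: "qvec (form A x (rscale y v) + form A (rscale y v) x) = 0"
    proof -
      have "qvec (form A x (rscale y v) + form A (rscale y v) x) = qvec (\<sigma> x y * v)"
        using qvec_simps(5)[of "qcnj (form A y x) * v"]
        by (simp add: \<sigma>_def left_diff_distrib qvec_def)
      then show ?thesis
        by (simp add: orth qvec_def)
    qed
    have "qvec (form A z z) = norm q *\<^sub>R p + norm p *\<^sub>R qvec (qcnj v * form A y y * v)"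
      unfolding z_def form_combination qvec_simps(1,3)[of "_ + _"] qvec_simps(3) cross
      by (simp add: p_def mult.assoc)
    also have "qvec (qcnj v * form A y y * v) = qcnj v * q * v"
      using v by (simp add: qvec_conjugate q_def)
    also have "norm p *\<^sub>R (qcnj v * q * v) = - (norm q *\<^sub>R p)"
      using v by simp
    finally have "qvec (form A z z) = 0"
      by simp
    with \<open>z \<noteq> 0\<close> show thesis
      using that upper_bildI[of z A "qre (form A z z) / (norm z)\<^sup>2" 0] by simp
  qed
qed

lemma quat_of_complex_in_numerical_range:
  "quat_of_complex z \<in> numerical_range A \<longleftrightarrow> Complex (Re z) \<bar>Im z\<bar> \<in> upper_bild A"
proof
  assume "quat_of_complex z \<in> numerical_range A"
  then obtain x where x: "norm x = 1" "form A x x = quat_of_complex z"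
    by (auto simp: numerical_range_def form_def)
  have "norm (qvec (quat_of_complex z)) = \<bar>Im z\<bar>"
    using norm_quat_power2[of "qvec (quat_of_complex z)"] by (simp add: quat_of_complex_def)
      (metis abs_norm_cancel power2_eq_iff abs_minus_cancel)
  with x show "Complex (Re z) \<bar>Im z\<bar> \<in> upper_bild A"
    by (auto simp: upper_bild_def quat_of_complex_def intro!: image_eqI[of _ _ x])
next
  assume "Complex (Re z) \<bar>Im z\<bar> \<in> upper_bild A"
  then obtain x where x: "norm x = 1" "qre (form A x x) = Re z" "norm (qvec (form A x x)) = \<bar>Im z\<bar>"
    by (rule upper_bildE)
  have "norm (qvec (quat_of_complex z)) = \<bar>Im z\<bar>"
    using norm_quat_power2[of "qvec (quat_of_complex z)"] by (simp add: quat_of_complex_def)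
      (metis abs_norm_cancel power2_eq_iff abs_minus_cancel)
  then obtain v where v: "norm v = 1" "qcnj v * form A x x * v = quat_of_complex z"
    using quat_similar[of "quat_of_complex z" "form A x x"] x by (auto simp: quat_of_complex_def)
  then show "quat_of_complex z \<in> numerical_range A"
    using x unfolding numerical_range_def form_def[symmetric]
    by (intro CollectI exI[of _ "rscale x v"]) (simp add: mult.assoc)
qed

section \<open>One-sided tangents and the star-center of a symmetric planar set\<close>

lemma compact_LEAST:
  fixes S :: "real set"
  assumes "compact S" "S \<noteq> {}"
  shows "(LEAST x. x \<in> S) \<in> S" "\<And>x. x \<in> S \<Longrightarrow> (LEAST x. x \<in> S) \<le> x"
proof -
  obtain s where s: "s \<in> S" "\<forall>x\<in>S. s \<le> x"
    using compact_attains_inf[OF assms] by blast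
  then have "(LEAST x. x \<in> S) = s"
    by (intro Least_equality) auto
  with s show "(LEAST x. x \<in> S) \<in> S" "\<And>x. x \<in> S \<Longrightarrow> (LEAST x. x \<in> S) \<le> x"
    by auto
qed

lemma compact_GREATEST:
  fixes S :: "real set"
  assumes "compact S" "S \<noteq> {}"
  shows "(GREATEST x. x \<in> S) \<in> S" "\<And>x. x \<in> S \<Longrightarrow> x \<le> (GREATEST x. x \<in> S)"
proof -
  obtain s where s: "s \<in> S" "\<forall>x\<in>S. x \<le> s"
    using compact_attains_sup[OF assms] by blast
  then have "(GREATEST x. x \<in> S) = s"
    by (intro Greatest_equality) auto
  with s show "(GREATEST x. x \<in> S) \<in> S" "\<And>x. x \<in> S \<Longrightarrow> x \<le> (GREATEST x. x \<in> S)"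
    by auto
qed

lemma compact_slice:
  assumes "compact C"
  shows "compact {x. Complex x y \<in> C}"
proof -
  have "{x. Complex x y \<in> C} = Re ` (C \<inter> {z. Im z = y})"
    by (auto intro!: image_eqI[of _ Re "Complex _ y"])
  moreover have "closed {z. Im z = y}"
    by (intro closed_Collect_eq continuous_intros)
  ultimately show ?thesis
    using assms by (simp add: compact_Int_closed compact_continuous_image continuous_on_Re)
qed

lemma convex_on_left_boundary:
  assumes "convex C" "convex I"
    and "\<And>y. y \<in> I \<Longrightarrow> Complex (f y) y \<in> C"
    and "\<And>x y. y \<in> I \<Longrightarrow> Complex x y \<in> C \<Longrightarrow> f y \<le> x"
  shows "convex_on I f"
  unfolding convex_on_def
proof (intro conjI ballI allI impI)
  fix y y' u v :: real
  assume y: "y \<in> I" "y' \<in> I" and uv: "0 \<le> u" "0 \<le> v" "u + v = 1"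
  have "u *\<^sub>R Complex (f y) y + v *\<^sub>R Complex (f y') y' \<in> C"
    using y uv assms by (intro convexD) auto
  moreover have "u *\<^sub>R Complex (f y) y + v *\<^sub>R Complex (f y') y' = Complex (u * f y + v * f y') (u * y + v * y')"
    by (simp add: complex_eq_iff)
  ultimately have "Complex (u * f y + v * f y') (u * y + v * y') \<in> C"
    by simp
  moreover have "u *\<^sub>R y + v *\<^sub>R y' \<in> I"
    using y uv assms(2) by (intro convexD) auto
  ultimately show "f (u *\<^sub>R y + v *\<^sub>R y') \<le> u * f y + v * f y'"
    using assms(4) by simp
qed (fact assms(2))

text \<open>The difference quotients of a convex function increase, so they converge to their supremum, which
  may be \<open>\<infinity>\<close> at an endpoint of the interval.\<close>

lemma tendsto_left_difference_quotient:
  assumes "convex_on {c..0} f" "c < 0"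
  shows "((\<lambda>y. ereal ((f y - f 0) / (y - 0))) \<longlongrightarrow> (SUP y\<in>{c..<0}. ereal ((f y - f 0) / y))) (at_left 0)"
    (is "(?Q \<longlongrightarrow> ?S) _")
proof -
  have mono: "(f y - f 0) / y \<le> (f y' - f 0) / y'" if "c \<le> y" "y < y'" "y' < 0" for y y'
    using convex_on_slope_le(2)[OF assms(1), of y 0 y'] that by simp
  have near: "\<forall>\<^sub>F y in at_left 0. y \<in> {d<..<0}" if "d < 0" for d :: real
    using that by (rule eventually_at_left_real)
  show ?thesis
  proof (rule order_tendstoI)
    fix s assume "s < ?S"
    then obtain d where d: "d \<in> {c..<0}" "s < ereal ((f d - f 0) / d)"
      by (auto simp: less_SUP_iff)
    show "\<forall>\<^sub>F y in at_left 0. s < ?Q y"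
    proof (rule eventually_mono[OF near])
      show "s < ?Q y" if "y \<in> {d<..<0}" for y
        using mono[of d y] that d by (auto intro: less_le_trans)
    qed (use d in auto)
  next
    fix s assume "?S < s"
    show "\<forall>\<^sub>F y in at_left 0. ?Q y < s"
    proof (rule eventually_mono[OF near[OF assms(2)]])
      fix y assume "y \<in> {c<..<0}"
      then have "?Q y \<le> ?S"
        by (auto intro!: SUP_upper)
      with \<open>?S < s\<close> show "?Q y < s"
        by simp
    qed
  qed
qed

lemma left_deriv_convex:
  assumes "convex_on {c..0} f" "c < 0"
  shows "left_deriv f 0 = (SUP y\<in>{c..<0}. ereal ((f y - f 0) / y))"
  unfolding left_deriv_def
  by (rule tendsto_Lim[OF _ tendsto_left_difference_quotient[OF assms]]) simp

lemma left_deriv_concave: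
  assumes "convex_on {c..0} (\<lambda>y. - f y)" "c < 0"
  shows "left_deriv f 0 = - left_deriv (\<lambda>y. - f y) 0"
proof -
  have "((\<lambda>y. ereal ((- f y - - f 0) / (y - 0))) \<longlongrightarrow> left_deriv (\<lambda>y. - f y) 0) (at_left 0)"
    using tendsto_left_difference_quotient[OF assms] left_deriv_convex[OF assms] by simp
  then have "((\<lambda>y. - ereal ((- f y - - f 0) / (y - 0))) \<longlongrightarrow> - left_deriv (\<lambda>y. - f y) 0) (at_left 0)"
    by (rule tendsto_uminus_ereal)
  moreover have "- ereal ((- f y - - f 0) / (y - 0)) = ereal ((f y - f 0) / (y - 0))" for y
    by (simp add: minus_divide_left del: minus_divide_left[symmetric])
  ultimately show ?thesis
    unfolding left_deriv_def by (intro tendsto_Lim) simp_all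
qed

text \<open>The value at \<open>t > 0\<close> of the left tangent in \<open>0\<close> is the supremum of the values of the chord lines
  through the points over \<open>y < 0\<close> and \<open>0\<close>. If the slope of the tangent is infinite, both sides fail.\<close>

lemma tangent_le_iff_chords_le:
  assumes "convex_on {c..0} f" "c < 0" "0 < t"
  shows "left_deriv f 0 * ereal t + ereal (f 0) \<le> ereal s \<longleftrightarrow>
    (\<forall>y\<in>{c..<0}. (f y - f 0) / y * t + f 0 \<le> s)"
proof -
  have le: "d * ereal t + ereal (f 0) \<le> ereal s \<longleftrightarrow> d \<le> ereal ((s - f 0) / t)" for d :: ereal
    using assms(3) by (cases d) (auto simp: field_simps)
  show ?thesis
    unfolding le left_deriv_convex[OF assms(1,2)] SUP_le_iff
    using assms(3) by (auto simp: field_simps)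
qed

lemma tangent_ge_iff_chords_ge:
  assumes "convex_on {c..0} (\<lambda>y. - f y)" "c < 0" "0 < t"
  shows "ereal s \<le> left_deriv f 0 * ereal t + ereal (f 0) \<longleftrightarrow>
    (\<forall>y\<in>{c..<0}. s \<le> (f y - f 0) / y * t + f 0)"
proof -
  have "ereal s \<le> left_deriv f 0 * ereal t + ereal (f 0) \<longleftrightarrow>
      left_deriv (\<lambda>y. - f y) 0 * ereal t + ereal (- f 0) \<le> ereal (- s)"
    unfolding left_deriv_concave[OF assms(1,2)]
    by (cases "left_deriv (\<lambda>y. - f y) 0") (use assms(3) in auto)
  also have "\<dots> \<longleftrightarrow> (\<forall>y\<in>{c..<0}. (- f y - - f 0) / y * t + - f 0 \<le> - s)"
    by (rule tangent_le_iff_chords_le[OF assms])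
  also have "\<dots> \<longleftrightarrow> (\<forall>y\<in>{c..<0}. s \<le> (f y - f 0) / y * t + f 0)"
  proof (rule ball_cong[OF refl])
    fix y
    have "(- f y - - f 0) / y = - ((f y - f 0) / y)"
      by (simp add: minus_divide_left del: minus_divide_left[symmetric])
    then have "(- f y - - f 0) / y * t = - ((f y - f 0) / y * t)"
      by (simp only: mult_minus_left)
    then show "(- f y - - f 0) / y * t + - f 0 \<le> - s \<longleftrightarrow> s \<le> (f y - f 0) / y * t + f 0"
      by linarith
  qed
  finally show ?thesis .
qed

text \<open>The abscissa at which the line through \<open>w\<close> and \<open>z\<close>, points on different sides of the real axis,
  crosses this axis.\<close>

definition axis_crossing :: "complex \<Rightarrow> complex \<Rightarrow> real" where
  "axis_crossing w z = (Re z * Im w - Re w * Im z) / (Im w - Im z)"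

lemma axis_crossing_in_segment:
  assumes "0 < Im w" "Im z < 0"
  shows "of_real (axis_crossing w z) = (1 - Im w / (Im w - Im z)) *\<^sub>R w + (Im w / (Im w - Im z)) *\<^sub>R z"
    and "of_real (axis_crossing w z) \<in> closed_segment w z"
proof -
  show *: "of_real (axis_crossing w z) = (1 - Im w / (Im w - Im z)) *\<^sub>R w + (Im w / (Im w - Im z)) *\<^sub>R z"
    using assms by (simp add: complex_eq_iff axis_crossing_def divide_simps)
  show "of_real (axis_crossing w z) \<in> closed_segment w z"
    unfolding closed_segment_def * using assms
    by (intro CollectI exI[of _ "Im w / (Im w - Im z)"] conjI refl) (simp_all add: divide_simps)
qed

text \<open>The segment from \<open>w\<close> to \<open>z\<close> crosses the axis to the right of \<open>c\<close> exactly if \<open>w\<close> lies to the right of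
  the line through \<open>c\<close> and \<open>z\<close>.\<close>

lemma le_axis_crossing_iff:
  assumes "0 < Im w" "Im z < 0"
  shows "c \<le> axis_crossing w z \<longleftrightarrow> (Re z - c) / Im z * Im w + c \<le> Re w"
proof -
  have "(Re z - c) / Im z * Im w + c \<le> Re w \<longleftrightarrow> (Re z - c) * Im w / Im z \<le> Re w - c"
    by (simp add: algebra_simps)
  also have "\<dots> \<longleftrightarrow> (Re w - c) * Im z \<le> (Re z - c) * Im w"
    using assms by (simp add: neg_divide_le_eq)
  also have "\<dots> \<longleftrightarrow> c \<le> axis_crossing w z"
    using assms by (simp add: axis_crossing_def le_divide_eq algebra_simps)
  finally show ?thesis
    by simp
qed

lemma axis_crossing_le_iff:
  assumes "0 < Im w" "Im z < 0"
  shows "axis_crossing w z \<le> c \<longleftrightarrow> Re w \<le> (Re z - c) / Im z * Im w + c"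
proof -
  have "Re w \<le> (Re z - c) / Im z * Im w + c \<longleftrightarrow> Re w - c \<le> (Re z - c) * Im w / Im z"
    by (simp add: algebra_simps)
  also have "\<dots> \<longleftrightarrow> (Re z - c) * Im w \<le> (Re w - c) * Im z"
    using assms by (simp add: neg_le_divide_eq)
  also have "\<dots> \<longleftrightarrow> axis_crossing w z \<le> c"
    using assms by (simp add: axis_crossing_def divide_le_eq algebra_simps)
  finally show ?thesis
    by simp
qed

lemma star_center_iff_segments:
  "w \<in> star_center B \<longleftrightarrow> w \<in> B \<and> (\<forall>z\<in>B. closed_segment w z \<subseteq> B)"
  unfolding star_center_def closed_segment_def by fastforce

lemma symmetric_set_contains_segment:
  assumes sym: "\<And>z. cnj z \<in> B \<longleftrightarrow> z \<in> B"
    and conv: "convex (B \<inter> {z. 0 \<le> Im z})"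
    and uv: "u \<in> B" "v \<in> B" "0 \<le> Im u \<and> 0 \<le> Im v \<or> Im u \<le> 0 \<and> Im v \<le> 0"
  shows "closed_segment u v \<subseteq> B"
proof -
  have upper: "closed_segment u v \<subseteq> B" if "u \<in> B" "v \<in> B" "0 \<le> Im u" "0 \<le> Im v" for u v
    using closed_segment_subset[OF _ _ conv, of u v] that by auto
  have "closed_segment u v \<subseteq> B" if "Im u \<le> 0" "Im v \<le> 0"
  proof
    fix z assume "z \<in> closed_segment u v"
    then have "cnj z \<in> closed_segment (cnj u) (cnj v)"
      by (auto simp: closed_segment_def)
    then show "z \<in> B"
      using upper[of "cnj u" "cnj v"] that uv sym by auto
  qed
  with uv upper show ?thesis
    by blast
qed

text \<open>A segment between the two halves of \<open>B\<close> splits at its crossing point into one segment in each half.\<close>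

lemma star_center_iff_crossings:
  assumes sym: "\<And>z. cnj z \<in> B \<longleftrightarrow> z \<in> B"
    and conv: "convex (B \<inter> {z. 0 \<le> Im z})"
    and real: "\<And>x. of_real x \<in> B \<longleftrightarrow> m \<le> x \<and> x \<le> M"
    and w: "w \<in> B" "0 < Im w"
  shows "w \<in> star_center B \<longleftrightarrow>
    (\<forall>z\<in>B. Im z < 0 \<longrightarrow> m \<le> axis_crossing w z \<and> axis_crossing w z \<le> M)"
proof
  assume "w \<in> star_center B"
  then show "\<forall>z\<in>B. Im z < 0 \<longrightarrow> m \<le> axis_crossing w z \<and> axis_crossing w z \<le> M"
    unfolding star_center_iff_segments real[symmetric]
    using axis_crossing_in_segment(2)[OF w(2)] by blast
next
  assume cross: "\<forall>z\<in>B. Im z < 0 \<longrightarrow> m \<le> axis_crossing w z \<and> axis_crossing w z \<le> M"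
  note segment = symmetric_set_contains_segment[OF sym conv]
  have "closed_segment w z \<subseteq> B" if z: "z \<in> B" for z
  proof (cases "0 \<le> Im z")
    case True
    then show ?thesis
      using segment w z by simp
  next
    case False
    define p where "p = complex_of_real (axis_crossing w z)"
    have "p \<in> closed_segment w z" "p \<in> B"
      using axis_crossing_in_segment(2)[of w z] w z False cross real by (auto simp: p_def)
    moreover have "Im p = 0"
      by (simp add: p_def)
    ultimately have "closed_segment w p \<union> closed_segment p z \<subseteq> B"
      using segment[of w p] segment[of p z] w z False by auto
    with \<open>p \<in> closed_segment w z\<close> show ?thesis
      by (simp add: Un_closed_segment)
  qed
  with w show "w \<in> star_center B"
    by (simp add: star_center_iff_segments)
qed

text \<open>At each height \<open>y < 0\<close> it is enough to look at the crossing of the segment to the extreme points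
  \<open>(f y, y)\<close> and \<open>(g y, y)\<close>, and the tangents collect these conditions over all heights. A point on
  the real axis belongs to both convex halves of \<open>B\<close>; there both sides of the equivalence hold, whatever
  the slopes are, because \<open>0 * \<infinity> = 0\<close>.\<close>

theorem star_center_iff_tangents:
  assumes B: "compact B" "convex (B \<inter> {z. 0 \<le> Im z})" "\<And>z. cnj z \<in> B \<longleftrightarrow> z \<in> B"
    and meets: "complex_of_real h \<in> B"
    and m: "m = (LEAST x. complex_of_real x \<in> B)" and M: "M = (GREATEST x. complex_of_real x \<in> B)"
    and c: "c = (LEAST y. \<exists>x. Complex x y \<in> B)"
    and f: "\<And>y. y \<in> {c..0} \<Longrightarrow> f y = (LEAST x. Complex x y \<in> B \<inter> {z. Im z \<le> 0})"
    and g: "\<And>y. y \<in> {c..0} \<Longrightarrow> g y = (GREATEST x. Complex x y \<in> B \<inter> {z. Im z \<le> 0})"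
    and w: "w \<in> B" "0 \<le> Im w"
  shows "left_deriv f 0 * ereal (Im w) + ereal m \<le> ereal (Re w) \<and>
      ereal (Re w) \<le> left_deriv g 0 * ereal (Im w) + ereal M \<longleftrightarrow> w \<in> star_center B"
proof -
  define C where "C = B \<inter> {z. Im z \<le> 0}"
  have C: "compact C"
    unfolding C_def using B(1) by (intro compact_Int_closed closed_halfspace_Im_le) 
  have convC: "convex C"
  proof -
    have "C = cnj ` (B \<inter> {z. 0 \<le> Im z})"
      using B(3) by (auto simp: C_def intro!: image_eqI[of _ cnj "cnj _"])
    then show ?thesis
      using convex_linear_image[OF _ B(2), of cnj] by (simp add: linear_cnj)
  qed
  have slice0: "Complex x 0 \<in> B \<longleftrightarrow> complex_of_real x \<in> B" for x
    by (simp add: complex_of_real_def)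
  have cpt0: "compact {x. complex_of_real x \<in> B}" "{x. complex_of_real x \<in> B} \<noteq> {}"
    using compact_slice[OF B(1), of 0] meets by (auto simp: slice0)
  have mM: "complex_of_real m \<in> B" "complex_of_real M \<in> B"
    and mM_bound: "complex_of_real x \<in> B \<Longrightarrow> m \<le> x \<and> x \<le> M" for x
    using compact_LEAST[OF cpt0] compact_GREATEST[OF cpt0] by (auto simp: m M)
  have real: "complex_of_real x \<in> B \<longleftrightarrow> m \<le> x \<and> x \<le> M" for x
  proof
    assume x: "m \<le> x \<and> x \<le> M"
    then have "x \<in> closed_segment m M"
      by (simp add: closed_segment_eq_real_ivl)
    then have "complex_of_real x \<in> closed_segment (of_real m) (of_real M)"
      by simp
    moreover have "closed_segment (complex_of_real m) (of_real M) \<subseteq> B \<inter> {z. 0 \<le> Im z}"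
      by (rule closed_segment_subset) (use mM B in auto)
    ultimately show "complex_of_real x \<in> B"
      by blast
  qed (rule mM_bound)
  have "compact (Im ` B)" "Im ` B \<noteq> {}"
    using B(1) w by (auto intro!: compact_continuous_image continuous_intros)
  moreover have "y \<in> Im ` B \<longleftrightarrow> (\<exists>x. Complex x y \<in> B)" for y
    by (metis (no_types, lifting) complex.collapse complex.sel(2) imageE image_eqI)
  ultimately have c': "\<exists>x. Complex x c \<in> B" "z \<in> B \<Longrightarrow> c \<le> Im z" for z
    using compact_LEAST[of "Im ` B"] by (auto simp: c)
  show ?thesis
  proof (cases "Im w = 0")
    case True
    then have wr: "w = of_real (Re w)"
      by (simp add: complex_eq_iff)
    have "closed_segment w z \<subseteq> B" if "z \<in> B" for z
      using symmetric_set_contains_segment[OF B(3,2), of w z] that w True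
      by (cases "0 \<le> Im z") auto
    then have "w \<in> star_center B"
      using w by (simp add: star_center_iff_segments)
    moreover have "m \<le> Re w \<and> Re w \<le> M"
      using real w wr by metis
    ultimately show ?thesis
      using True by (simp add: zero_ereal_def[symmetric])
  next
    case False
    with w have pos: "0 < Im w"
      by simp
    \<comment> \<open>The mirror image of \<open>w\<close> shows that \<open>B\<close> reaches below the real axis.\<close>
    have "c \<le> Im (cnj w)"
      using c' w B(3) by blast
    with pos have "c < 0"
      by simp
    \<comment> \<open>Every height between \<open>c\<close> and \<open>0\<close> occurs in \<open>C\<close>, on the segment from a lowest point to \<open>m\<close>.\<close>
    have ne: "{x. Complex x y \<in> C} \<noteq> {}" if y: "y \<in> {c..0}" for y
    proof -
      obtain x where x: "Complex x c \<in> C"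
        using c' \<open>c < 0\<close> by (auto simp: C_def)
      have m0: "Complex m 0 \<in> C"
        using mM by (simp add: C_def slice0)
      have "(y / c) *\<^sub>R Complex x c + (1 - y / c) *\<^sub>R Complex m 0 \<in> C"
        by (rule convexD[OF convC x m0]) (use y \<open>c < 0\<close> in \<open>auto simp: divide_simps\<close>)
      moreover have "(y / c) *\<^sub>R Complex x c + (1 - y / c) *\<^sub>R Complex m 0
          = Complex (y / c * x + (1 - y / c) * m) y"
        using \<open>c < 0\<close> by (simp add: complex_eq_iff)
      ultimately show ?thesis
        by auto
    qed
    have f': "Complex (f y) y \<in> C" "\<And>x. Complex x y \<in> C \<Longrightarrow> f y \<le> x"
      and g': "Complex (g y) y \<in> C" "\<And>x. Complex x y \<in> C \<Longrightarrow> x \<le> g y" if "y \<in> {c..0}" for y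
      using compact_LEAST[OF compact_slice[OF C] ne[OF that]]
        compact_GREATEST[OF compact_slice[OF C] ne[OF that]]
      unfolding f[OF that, folded C_def] g[OF that, folded C_def] by auto
    have f0: "f 0 = m" and g0: "g 0 = M"
      using \<open>c < 0\<close> f[of 0] g[of 0] by (simp_all add: m M slice0)
    have convf: "convex_on {c..0} f"
      by (rule convex_on_left_boundary[OF convC]) (use f' in auto)
    have convg: "convex_on {c..0} (\<lambda>y. - g y)"
    proof (rule convex_on_left_boundary)
      define r where "r z = Complex (- Re z) (Im z)" for z
      have "linear r"
        by (rule linearI) (simp_all add: r_def complex_eq_iff)
      then show "convex (r ` C)"
        using convC by (rule convex_linear_image)
      show "Complex (- g y) y \<in> r ` C" if "y \<in> {c..0}" for y
        using g'[OF that] by (auto simp: r_def intro!: image_eqI[of _ _ "Complex (g y) y"])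
      show "- g y \<le> x" if y: "y \<in> {c..0}" and x: "Complex x y \<in> r ` C" for x y
      proof -
        have "Complex (- x) y \<in> C"
          using x by (auto simp: r_def)
        then show ?thesis
          using g'(2)[OF y] by force
      qed
    qed simp
    have "left_deriv f 0 * ereal (Im w) + ereal m \<le> ereal (Re w) \<longleftrightarrow>
        (\<forall>y\<in>{c..<0}. m \<le> axis_crossing w (Complex (f y) y))"
      using tangent_le_iff_chords_le[OF convf \<open>c < 0\<close> pos] pos
      by (simp add: f0 le_axis_crossing_iff)
    also have "\<dots> \<longleftrightarrow> (\<forall>z\<in>B. Im z < 0 \<longrightarrow> m \<le> axis_crossing w z)"
    proof (intro iffI ballI impI)
      fix z assume *: "\<forall>y\<in>{c..<0}. m \<le> axis_crossing w (Complex (f y) y)"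
        and z: "z \<in> B" "Im z < 0"
      have y: "Im z \<in> {c..<0}"
        using z c' by simp
      then have "f (Im z) \<le> Re z"
        using f'(2)[of "Im z" "Re z"] z by (simp add: C_def)
      then have "(Re z - m) / Im z * Im w \<le> (f (Im z) - m) / Im z * Im w"
        using z pos by (intro mult_right_mono divide_right_mono_neg) auto
      moreover have "(f (Im z) - m) / Im z * Im w + m \<le> Re w"
        using * y pos z by (simp add: le_axis_crossing_iff)
      ultimately show "m \<le> axis_crossing w z"
        using pos z by (simp add: le_axis_crossing_iff)
    qed (use f' in \<open>auto simp: C_def\<close>)
    finally have left: "left_deriv f 0 * ereal (Im w) + ereal m \<le> ereal (Re w) \<longleftrightarrow>
        (\<forall>z\<in>B. Im z < 0 \<longrightarrow> m \<le> axis_crossing w z)" .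
    have "ereal (Re w) \<le> left_deriv g 0 * ereal (Im w) + ereal M \<longleftrightarrow>
        (\<forall>y\<in>{c..<0}. axis_crossing w (Complex (g y) y) \<le> M)"
      using tangent_ge_iff_chords_ge[OF convg \<open>c < 0\<close> pos] pos
      by (simp add: g0 axis_crossing_le_iff)
    also have "\<dots> \<longleftrightarrow> (\<forall>z\<in>B. Im z < 0 \<longrightarrow> axis_crossing w z \<le> M)"
    proof (intro iffI ballI impI)
      fix z assume *: "\<forall>y\<in>{c..<0}. axis_crossing w (Complex (g y) y) \<le> M"
        and z: "z \<in> B" "Im z < 0"
      have y: "Im z \<in> {c..<0}"
        using z c' by simp
      then have "Re z \<le> g (Im z)"
        using g'(2)[of "Im z" "Re z"] z by (simp add: C_def)
      then have "(g (Im z) - M) / Im z * Im w \<le> (Re z - M) / Im z * Im w"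
        using z pos by (intro mult_right_mono divide_right_mono_neg) auto
      moreover have "Re w \<le> (g (Im z) - M) / Im z * Im w + M"
        using * y pos z by (simp add: axis_crossing_le_iff)
      ultimately show "axis_crossing w z \<le> M"
        using pos z by (simp add: axis_crossing_le_iff)
    qed (use g' in \<open>auto simp: C_def\<close>)
    finally have right: "ereal (Re w) \<le> left_deriv g 0 * ereal (Im w) + ereal M \<longleftrightarrow>
        (\<forall>z\<in>B. Im z < 0 \<longrightarrow> axis_crossing w z \<le> M)" .
    show ?thesis
      unfolding left right star_center_iff_crossings[OF B(3,2) real w(1) pos] by blast
  qed
qed

section \<open>The star-center of the bild\<close>

lemma quat_of_complex_of_real: "quat_of_complex (complex_of_real x) = of_real x"
  by (simp add: quat_of_complex_def quat_eq_iff)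

theorem theorem4p3:
  fixes A :: "quat ^ 'n ^ 'n"
    and W :: "quat set"
    and B Bplus Bminus :: "complex set"
    and m M y\<^sub>m :: real
    and x\<^sub>1 x\<^sub>2 :: "real \<Rightarrow> real"
    and a b :: ereal
    and l L :: "real \<Rightarrow> ereal"
    and \<omega> :: complex
  assumes "CARD('n) \<ge> 2"
    and "\<not> hermitian A"
    and "W = numerical_range A"
    and "B = {z. quat_of_complex z \<in> W}"
    and "Bplus = {z. quat_of_complex z \<in> W \<and> Im z \<ge> 0}"
    and "Bminus = {z. quat_of_complex z \<in> W \<and> Im z \<le> 0}"
    and "m = (LEAST x::real. of_real x \<in> W)"
    and "M = (GREATEST x::real. of_real x \<in> W)"
    and "y\<^sub>m = (LEAST y. \<exists>x. Complex x y \<in> B)"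
    and "\<And>y. y \<in> {y\<^sub>m..0} \<Longrightarrow> x\<^sub>1 y = (LEAST x. Complex x y \<in> Bminus)"
    and "\<And>y. y \<in> {y\<^sub>m..0} \<Longrightarrow> x\<^sub>2 y = (GREATEST x. Complex x y \<in> Bminus)"
    and "a = left_deriv x\<^sub>1 0"
    and "b = left_deriv x\<^sub>2 0"
    and "\<And>y. l y = a * ereal y + ereal m"
    and "\<And>y. L y = b * ereal y + ereal M"
    and "\<omega> \<in> Bplus"
  shows "(l (Im \<omega>) \<le> ereal (Re \<omega>) \<and> ereal (Re \<omega>) \<le> L (Im \<omega>)) \<longleftrightarrow> \<omega> \<in> star_center B"
proof -
  have B: "z \<in> B \<longleftrightarrow> Complex (Re z) \<bar>Im z\<bar> \<in> upper_bild A" for z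
    by (simp add: assms(3,4) quat_of_complex_in_numerical_range)
  have nonneg: "0 \<le> Im z" if "z \<in> upper_bild A" for z
    using that by (auto simp: upper_bild_def)
  have upper: "B \<inter> {z. 0 \<le> Im z} = upper_bild A"
    using nonneg by (auto simp: B)
  have sym: "cnj z \<in> B \<longleftrightarrow> z \<in> B" for z
    by (simp add: B)
  have "B = upper_bild A \<union> cnj ` upper_bild A"
  proof (intro equalityI subsetI)
    fix z assume "z \<in> B"
    then show "z \<in> upper_bild A \<union> cnj ` upper_bild A"
      unfolding upper[symmetric] using sym[of z]
      by (cases "0 \<le> Im z") (auto intro: image_eqI[of _ cnj "cnj z"])
  qed (use upper sym in auto)
  then have compact: "compact B"
    by (simp add: compact_Un compact_upper_bild compact_continuous_image continuous_intros)
  obtain h where "Complex h 0 \<in> upper_bild A"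
    using upper_bild_meets_axis assms(1) by blast
  then have h: "complex_of_real h \<in> B"
    by (simp add: B)
  have real: "of_real x \<in> W \<longleftrightarrow> complex_of_real x \<in> B" for x
    by (simp add: assms(4) quat_of_complex_of_real)
  have Bminus: "Bminus = B \<inter> {z. Im z \<le> 0}"
    using assms(4,6) by auto
  have \<omega>: "\<omega> \<in> B" "0 \<le> Im \<omega>"
    using assms(4,5,16) by auto
  show ?thesis
    unfolding assms(12-15)
    by (rule star_center_iff_tangents[OF compact _ sym h _ _ assms(9) _ _ \<omega>])
      (simp_all add: upper convex_upper_bild assms(7,8,10,11) real Bminus)
qed

end
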